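(* Let $\mathcal{A}$ be a non-degenerate conic in the projective plane over $\mathbb{K}\in\{\mathbb{R},\mathbb{C}\}$, and let $p_1,\dots,p_7$ be seven distinct points on $\mathcal{A}$. Then $p_1,p_2,\dots,p_7$ (in this order) are seven consecutive points of a proper Poncelet chain with circumscribed conic $\mathcal{A}$ if and only if \[[74][16][54][32]=[72][14][56][34].\]
   Context: Poncelet chains: given conics $\mathcal{A}$ (outer) and $\mathcal{B}$ (inner), a Poncelet chain is a sequence $p_1,p_2,\dots$ of points on $\mathcal{A}$ obtained as follows: $l_1$ is a tangent to $\mathcal{B}$ through $p_1$; $p_{i+1}$ is the intersection of $l_i$ with $\mathcal{A}$ other than $p_i$; $l_{i+1}$ is the tangent to $\mathcal{B}$ through $p_{i+1}$ other than $l_i$. Thus consecutive points are joined by lines tangent to $\mathcal{B}$. The chain is proper if all its points are distinct. "$p_1,\dots,p_7$ form a proper Poncelet chain" means there is a conic $\mathcal{B}$ for which they are seven consecutive points of such a chain. Bracket notation: fix a projective parametrization of $\mathcal{A}$ by the projective line $\mathbb{KP}^1$ (e.g. via stereographic projection from a point of $\mathcal{A}$), so each point $p_i$ on $\mathcal{A}$ has homogeneous coordinates $v_i\in\mathbb{K}^2\setminus\{0\}$. Writing point $p_i$ simply as $i$, the bracket $[ij]$ denotes the $2\times 2$ determinant $\det(v_i,v_j)$. The stated equation is multihomogeneous and invariant under projective changes of the parametrization, so its validity does not depend on the choices made. *)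

theory Defs
  imports "HOL-Analysis.Analysis"
begin

text \<open>
  Points and lines of the projective plane over \<open>'k\<close> are given by homogeneous coordinates,
  that is, by nonzero vectors in \<open>'k ^ 3\<close> up to \<open>same_proj\<close>.
\<close>

definition same_proj :: "'k::field ^ 'n \<Rightarrow> 'k ^ 'n \<Rightarrow> bool" where
  "same_proj x y \<longleftrightarrow> (\<exists>c. c \<noteq> 0 \<and> y = c *s x)"

definition incident :: "'k::field ^ 3 \<Rightarrow> 'k ^ 3 \<Rightarrow> bool" where
  "incident x l \<longleftrightarrow> scalar_product x l = 0"

definition on_conic :: "'k::field ^ 3 ^ 3 \<Rightarrow> 'k ^ 3 \<Rightarrow> bool" where
  "on_conic A x \<longleftrightarrow> scalar_product x (A *v x) = 0"

definition nondegenerate_conic :: "'k::field ^ 3 ^ 3 \<Rightarrow> bool" where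
  "nondegenerate_conic A \<longleftrightarrow> transpose A = A \<and> det A \<noteq> 0"

text \<open>
  A possibly degenerate conic is a primal/dual pair: the matrix \<open>B\<close> describes its points and
  the matrix \<open>B'\<close> its tangents. If \<open>B\<close> is invertible then \<open>B'\<close> is the inverse of \<open>B\<close> up to a
  nonzero scalar (\<open>tangent_line_nondegenerate\<close> below recovers the usual tangents). The degenerate
  pairs are needed for the inner conic: its tangents may be the lines through one of two fixed
  points, with \<open>B\<close> the double line joining these points.
\<close>

definition primal_dual_conic :: "'k::field ^ 3 ^ 3 \<Rightarrow> 'k ^ 3 ^ 3 \<Rightarrow> bool" where
  "primal_dual_conic B B' \<longleftrightarrow>
     B \<noteq> 0 \<and> B' \<noteq> 0 \<and> transpose B = B \<and> transpose B' = B' \<and> (\<exists>c. B ** B' = mat c)"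

definition tangent_line :: "'k::field ^ 3 ^ 3 \<Rightarrow> 'k ^ 3 \<Rightarrow> bool" where
  "tangent_line B' l \<longleftrightarrow> scalar_product l (B' *v l) = 0"

text \<open>
  The line \<open>l\<close> meets \<open>A\<close> in exactly \<open>p\<close> and \<open>q\<close>; the case \<open>q = p\<close> means that \<open>l\<close> touches \<open>A\<close> at
  \<open>p\<close>. So \<open>q\<close> is the intersection of \<open>l\<close> with \<open>A\<close> other than \<open>p\<close>, counted with multiplicity.
\<close>

definition intersections_are ::
    "'k::field ^ 3 ^ 3 \<Rightarrow> 'k ^ 3 \<Rightarrow> 'k ^ 3 \<Rightarrow> 'k ^ 3 \<Rightarrow> bool" where
  "intersections_are A l p q \<longleftrightarrow>
     (\<forall>x. x \<noteq> 0 \<longrightarrow> (incident x l \<and> on_conic A x \<longleftrightarrow> same_proj x p \<or> same_proj x q))"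

text \<open>Dually, the tangents to the conic through \<open>p\<close> are exactly \<open>l\<close> and \<open>m\<close>.\<close>

definition tangents_are ::
    "'k::field ^ 3 ^ 3 \<Rightarrow> 'k ^ 3 \<Rightarrow> 'k ^ 3 \<Rightarrow> 'k ^ 3 \<Rightarrow> bool" where
  "tangents_are B' p l m \<longleftrightarrow>
     (\<forall>k. k \<noteq> 0 \<longrightarrow> (incident p k \<and> tangent_line B' k \<longleftrightarrow> same_proj k l \<or> same_proj k m))"

definition poncelet_chain ::
    "'k::field ^ 3 ^ 3 \<Rightarrow> 'k ^ 3 ^ 3 \<Rightarrow> 'k ^ 3 ^ 3 \<Rightarrow> nat \<Rightarrow> (nat \<Rightarrow> 'k ^ 3) \<Rightarrow> bool" where
  "poncelet_chain A B B' n p \<longleftrightarrow>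
     primal_dual_conic B B' \<and>
     (\<forall>i\<in>{1..n}. p i \<noteq> 0 \<and> on_conic A (p i)) \<and>
     (\<exists>l.
        (\<forall>i\<in>{1..<n}. l i \<noteq> 0 \<and> tangent_line B' (l i) \<and> incident (p i) (l i) \<and>
                     intersections_are A (l i) (p i) (p (i + 1))) \<and>
        (\<forall>i\<in>{1..<n - 1}. tangents_are B' (p (i + 1)) (l i) (l (i + 1))))"

definition pairwise_distinct_points :: "nat \<Rightarrow> (nat \<Rightarrow> 'k::field ^ 3) \<Rightarrow> bool" where
  "pairwise_distinct_points n p \<longleftrightarrow>
     (\<forall>i\<in>{1..n}. \<forall>j\<in>{1..n}. i \<noteq> j \<longrightarrow> \<not> same_proj (p i) (p j))"

definition proper_poncelet_chain ::
    "'k::field ^ 3 ^ 3 \<Rightarrow> 'k ^ 3 ^ 3 \<Rightarrow> 'k ^ 3 ^ 3 \<Rightarrow> nat \<Rightarrow> (nat \<Rightarrow> 'k ^ 3) \<Rightarrow> bool" where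
  "proper_poncelet_chain A B B' n p \<longleftrightarrow>
     poncelet_chain A B B' n p \<and> pairwise_distinct_points n p"

text \<open>
  A projective parametrization of a conic by the projective line: up to a projective
  transformation it is \<open>(s : t) \<mapsto> (s^2 : s t : t^2)\<close>. These are the maps obtained by stereographic
  projection from a point of the conic, for any choice of coordinates on the projective line.
\<close>

definition conic_parametrization ::
    "'k::field ^ 3 ^ 3 \<Rightarrow> ('k ^ 2 \<Rightarrow> 'k ^ 3) \<Rightarrow> bool" where
  "conic_parametrization A \<phi> \<longleftrightarrow>
     (\<exists>M :: 'k ^ 3 ^ 3. invertible M \<and>
        (\<forall>v. \<phi> v = M *v vector [(v $ 1)^2, v $ 1 * v $ 2, (v $ 2)^2])) \<and>
     (\<forall>v. on_conic A (\<phi> v))"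

definition bracket :: "'k::field ^ 2 \<Rightarrow> 'k ^ 2 \<Rightarrow> 'k" where
  "bracket u v = det (vector [u, v] :: 'k ^ 2 ^ 2)"

text \<open>Sanity checks of the notions above.\<close>

lemmas comps3 = scalar_product_def matrix_vector_mult_def sum_3 vec_eq_iff forall_3

lemma scalar_product_commute: "scalar_product x y = scalar_product y (x :: 'k::field ^ 3)"
  by (simp add: comps3 mult.commute)

lemma scalar_product_add:
  fixes x y z :: "'k::field ^ 3"
  shows "scalar_product x (y + z) = scalar_product x y + scalar_product x z"
    and "scalar_product (x + y) z = scalar_product x z + scalar_product y z"
  by (simp_all add: comps3 algebra_simps)

lemma scalar_product_scale:
  fixes x y :: "'k::field ^ 3"
  shows "scalar_product x (c *s y) = c * scalar_product x y"
    and "scalar_product (c *s x) y = c * scalar_product x y"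
  by (simp_all add: comps3 algebra_simps)

lemma scalar_product_transpose:
  fixes M :: "'k::field ^ 3 ^ 3"
  shows "scalar_product (M *v x) y = scalar_product x (transpose M *v y)"
  by (simp add: comps3 transpose_def algebra_simps)

lemma invertible_iff_ker:
  fixes M :: "'k::field ^ 3 ^ 3"
  shows "invertible M \<longleftrightarrow> (\<forall>x. M *v x = 0 \<longrightarrow> x = 0)"
  by (simp add: invertible_left_inverse matrix_left_invertible_ker)

lemma tangent_line_nondegenerate:
  assumes BB: "primal_dual_conic B B'" and B: "nondegenerate_conic B" and l: "l \<noteq> 0"
  shows "tangent_line B' l \<longleftrightarrow> (\<exists>x. x \<noteq> 0 \<and> on_conic B x \<and> same_proj (B *v x) l)"
proof -
  obtain c where c: "B ** B' = mat c" and B'0: "B' \<noteq> 0"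
    using BB unfolding primal_dual_conic_def by blast
  have ker: "x = 0" if "B *v x = 0" for x
    using B that invertible_iff_ker[of B]
    unfolding nondegenerate_conic_def invertible_det_nz by blast
  have BBl: "B *v (B' *v y) = c *s y" for y
  proof -
    have "B *v (B' *v y) = mat c *v y"
      by (simp add: matrix_vector_mul_assoc c)
    also have "mat c *v y = c *s y"
      by (simp add: comps3 mat_def)
    finally show ?thesis .
  qed
  have c0: "c \<noteq> 0"
  proof
    assume "c = 0"
    then have "B' *v y = 0 *v y" for y
      using BBl[of y] ker[of "B' *v y"] by simp
    then show False
      using B'0 matrix_eq[of B' 0] by blast
  qed
  show ?thesis
  proof
    assume t: "tangent_line B' l"
    let ?x = "B' *v l"
    have "?x \<noteq> 0" using BBl[of l] c0 l by auto
    moreover have "on_conic B ?x"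
      using t scalar_product_commute[of ?x l]
      unfolding on_conic_def tangent_line_def BBl scalar_product_scale by simp
    moreover have "same_proj (B *v ?x) l"
      unfolding same_proj_def BBl using c0
      by (intro exI[of _ "inverse c"]) (simp add: vector_smult_assoc)
    ultimately show "\<exists>x. x \<noteq> 0 \<and> on_conic B x \<and> same_proj (B *v x) l" by blast
  next
    assume "\<exists>x. x \<noteq> 0 \<and> on_conic B x \<and> same_proj (B *v x) l"
    then obtain x d where x: "on_conic B x" and d: "l = d *s (B *v x)"
      unfolding same_proj_def by blast
    have "B *v (B' *v l - (c * d) *s x) = c *s l - (c * d) *s (B *v x)"
      by (simp only: matrix_vector_mult_diff_distrib BBl vector_scalar_commute)
    also have "\<dots> = 0" unfolding d by (simp add: vector_smult_assoc)
    finally have "B' *v l = (c * d) *s x" using ker by fastforce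
    then have "scalar_product l (B' *v l) = c * d * (d * scalar_product (B *v x) x)"
      using d by (simp only: scalar_product_scale)
    then show "tangent_line B' l"
      using x scalar_product_commute[of x "B *v x"]
      by (simp add: tangent_line_def on_conic_def)
  qed
qed

lemma conic_parametrization_surj:
  fixes A :: "'k::field_char_0 ^ 3 ^ 3"
  assumes A: "nondegenerate_conic A" and par: "conic_parametrization A \<phi>"
    and x: "x \<noteq> 0" "on_conic A x"
  shows "\<exists>v. v \<noteq> 0 \<and> same_proj (\<phi> v) x"
proof -
  obtain M :: "'k ^ 3 ^ 3" where M: "invertible M"
    and \<phi>: "\<And>v. \<phi> v = M *v vector [(v $ 1)^2, v $ 1 * v $ 2, (v $ 2)^2]"
    and on: "\<And>v. on_conic A (\<phi> v)"
    using par unfolding conic_parametrization_def by blast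
  obtain M' where M': "M ** M' = mat 1"
    using M unfolding invertible_def by blast
  define y where "y = M' *v x"
  have y: "x = M *v y"
    by (simp add: y_def matrix_vector_mul_assoc M')
  define N where "N = transpose M ** A ** M"
  have form: "scalar_product (M *v w) (A *v (M *v w)) = scalar_product w (N *v w)" for w
    unfolding scalar_product_transpose N_def by (simp add: matrix_vector_mul_assoc matrix_mul_assoc)
  have tN: "transpose N = N"
    using A unfolding N_def nondegenerate_conic_def
    by (simp add: matrix_transpose_mul matrix_mul_assoc)
  have "N $ i $ j = N $ j $ i" for i j
  proof -
    have "N $ j $ i = transpose N $ i $ j" by (simp add: transpose_def)
    then show ?thesis unfolding tN by simp
  qed
  note sym = this[of 2 1] this[of 3 1] this[of 3 2]
  have "det N \<noteq> 0"
    using A M unfolding N_def nondegenerate_conic_def invertible_det_nz by (simp add: det_mul)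
  then have N0: "N \<noteq> 0"
    by (auto simp: det_3)
  have q: "N$1$1 * s^4 + 2 * (N$1$2 * (s^3 * t)) + (2 * N$1$3 + N$2$2) * (s^2 * t^2)
      + 2 * (N$2$3 * (s * t^3)) + N$3$3 * t^4 = 0" for s t
    using on[of "vector [s, t]"] unfolding on_conic_def \<phi> form
    by (simp add: scalar_product_def matrix_vector_mult_def sum_3 sym)
      (simp add: algebra_simps power2_eq_square power3_eq_cube power4_eq_xxxx)
  have n1: "N$1$1 = 0" using q[of 1 0] by simp
  have n3: "N$3$3 = 0" using q[of 0 1] by simp
  have e1: "2 * N$1$2 + (2 * N$1$3 + N$2$2) + 2 * N$2$3 = 0"
    using q[of 1 1] n1 n3 by simp
  have e2: "- 2 * N$1$2 + (2 * N$1$3 + N$2$2) - 2 * N$2$3 = 0"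
    using q[of 1 "-1"] n1 n3 by simp
  have e3: "4 * N$1$2 + 4 * (2 * N$1$3 + N$2$2) + 16 * N$2$3 = 0"
    using q[of 1 2] n1 n3 by (simp add: algebra_simps)
  have "2 * (2 * N$1$3 + N$2$2) = 0" using e1 e2 by algebra
  then have "2 * N$1$3 + N$2$2 = 0" by (simp only: mult_eq_0_iff) simp
  then have n22: "N$2$2 = - 2 * N$1$3" by algebra
  have "12 * N$2$3 = 0" using e1 e3 n22 by algebra
  then have n23: "N$2$3 = 0" by simp
  have n12: "N$1$2 = 0" using e1 n22 n23 by simp
  have n13: "N$1$3 \<noteq> 0"
    using N0 n1 n3 n22 n23 n12 sym by (auto simp: vec_eq_iff forall_3)
  have "scalar_product y (N *v y) = 0"
    using x(2) unfolding on_conic_def y form .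
  then have "2 * N$1$3 * (y$1 * y$3 - y$2 * y$2) = 0"
    by (simp add: scalar_product_def matrix_vector_mult_def sum_3 sym n1 n3 n22 n23 n12
        algebra_simps)
  then have yy: "y$2 * y$2 = y$1 * y$3" using n13 by simp
  have y0: "y \<noteq> 0" using x(1) y by auto
  show ?thesis
  proof (cases "y$1 = 0")
    case False
    let ?v = "vector [y$1, y$2] :: 'k ^ 2"
    have "vector [(?v $ 1)^2, ?v $ 1 * ?v $ 2, (?v $ 2)^2] = y$1 *s y"
      by (simp add: vec_eq_iff forall_3 power2_eq_square yy)
    then have "\<phi> ?v = y$1 *s x" unfolding \<phi> y by (simp only: vector_scalar_commute)
    then have "same_proj (\<phi> ?v) x"
      unfolding same_proj_def using False
      by (intro exI[of _ "inverse (y$1)"]) (simp add: vector_smult_assoc)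
    moreover have "?v \<noteq> 0" using False by (metis vector_2(1) zero_index)
    ultimately show ?thesis by blast
  next
    case True
    then have y2: "y$2 = 0" using yy by simp
    then have y3: "y$3 \<noteq> 0" using True y0 by (auto simp: vec_eq_iff forall_3)
    let ?v = "vector [0, 1] :: 'k ^ 2"
    have Y: "y = y$3 *s vector [(?v $ 1)^2, ?v $ 1 * ?v $ 2, (?v $ 2)^2]"
      using True y2 by (simp add: vec_eq_iff forall_3)
    have "x = y$3 *s \<phi> ?v"
      using arg_cong[OF Y, of "\<lambda>z. M *v z"] unfolding \<phi> y[symmetric]
      by (simp only: vector_scalar_commute)
    then have "same_proj (\<phi> ?v) x" unfolding same_proj_def using y3 by blast
    moreover have "?v \<noteq> 0" by (metis vector_2(2) zero_index zero_neq_one)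
    ultimately show ?thesis by blast
  qed
qed

lemma conic_parametrization_exists:
  fixes A :: "'k::field_char_0 ^ 3 ^ 3"
  assumes A: "nondegenerate_conic A" and c: "c \<noteq> 0" "on_conic A c"
  shows "\<exists>\<phi>. conic_parametrization A \<phi>"
proof -
  define b where "b = (\<lambda>x y. scalar_product x (A *v y))"
  have sym: "b x y = b y x" for x y
    using A scalar_product_transpose[of A y x] scalar_product_commute[of x "A *v y"]
    unfolding b_def nondegenerate_conic_def by simp
  have ladd: "b (x + y) z = b x z + b y z" and lsc: "b (r *s x) z = r * b x z" for x y z r
    unfolding b_def by (simp_all only: scalar_product_add scalar_product_scale)
  have radd: "b z (x + y) = b z x + b z y" and rsc: "b z (r *s x) = r * b z x" for x y z r
    using ladd lsc sym by simp_all
  have b0: "b 0 x = 0" "b x 0 = 0" for x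
    by (simp_all add: b_def scalar_product_def matrix_vector_mult_def)
  have nondeg: "x = 0" if "A *v x = 0" for x
    using A that invertible_iff_ker[of A]
    unfolding nondegenerate_conic_def invertible_det_nz by blast
  have bcc: "b c c = 0" using c(2) unfolding on_conic_def b_def .
  obtain d where d: "b c d \<noteq> 0"
  proof -
    obtain i where "(A *v c) $ i \<noteq> 0"
      using nondeg[of c] c(1) by (auto simp: vec_eq_iff)
    then have "b (axis i 1) c \<noteq> 0"
      unfolding b_def scalar_product_def axis_def
      by (simp add: if_distrib[of "\<lambda>u. u * _"] cong: if_cong)
    then show ?thesis using that sym by metis
  qed
  define g where "g = - b d d / (2 * b c d)"
  define f where "f = d + g *s c"
  have bcf: "b c f \<noteq> 0" using d by (simp add: f_def radd rsc bcc)
  have "2 * g * b c d = - b d d" using d by (simp add: g_def)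
  then have bff: "b f f = 0"
    by (simp add: f_def ladd radd lsc rsc bcc sym[of d c] algebra_simps)
  define u w where "u = A *v c" and "w = A *v f"
  define e :: "'k ^ 3" where "e = vector [u$2 * w$3 - u$3 * w$2, u$3 * w$1 - u$1 * w$3,
      u$1 * w$2 - u$2 * w$1]"
  have bec: "b e c = 0" and bef: "b e f = 0"
    unfolding b_def u_def[symmetric] w_def[symmetric]
    by (simp_all add: e_def scalar_product_def sum_3 algebra_simps)
  have e0: "e \<noteq> 0"
  proof
    assume "e = 0"
    then have cr: "u$2 * w$3 = u$3 * w$2" "u$3 * w$1 = u$1 * w$3" "u$1 * w$2 = u$2 * w$1"
      by (simp_all add: e_def vec_eq_iff forall_3)
    have "u \<noteq> 0" using nondeg[of c] c(1) unfolding u_def by blast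
    then obtain i where i: "u $ i \<noteq> 0" by (auto simp: vec_eq_iff)
    have ij: "u $ i * w $ j = w $ i * u $ j" for j
      using exhaust_3[of i] exhaust_3[of j] cr by (auto simp: mult.commute)
    have "u $ i *s w = w $ i *s u" by (simp add: vec_eq_iff ij)
    then have "b c (u $ i *s f) = b c (w $ i *s c)"
      unfolding b_def u_def w_def vector_scalar_commute by simp
    then show False using i bcf bcc by (simp add: rsc)
  qed
  have bas: "r = 0 \<and> s = 0 \<and> t = 0" if "r *s c + s *s e + t *s f = 0" "e \<noteq> 0" for r s t
  proof -
    have "b c (r *s c + s *s e + t *s f) = 0" "b f (r *s c + s *s e + t *s f) = 0"
      using that b0 by simp_all
    then have "r = 0" "t = 0"
      using bcf bec bef bcc bff by (simp_all add: radd rsc sym[of c e] sym[of f e] sym[of f c])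
    then show ?thesis using that by auto
  qed
  define P :: "'k ^ 3 ^ 3" where "P = vector [c, e, f]"
  have Pt: "transpose P *v y = y$1 *s c + y$2 *s e + y$3 *s f" for y :: "'k ^ 3"
    by (simp add: vec_eq_iff P_def transpose_def matrix_vector_mult_def sum_3 mult.commute)
  have invP: "invertible (transpose P)"
    unfolding invertible_iff_ker Pt
  proof (intro allI impI)
    fix y :: "'k ^ 3" assume "y$1 *s c + y$2 *s e + y$3 *s f = 0"
    from bas[OF this e0] show "y = 0" by (simp add: vec_eq_iff forall_3)
  qed
  have bee: "b e e \<noteq> 0"
  proof
    assume "b e e = 0"
    then have "P *v (A *v e) = 0"
      using bec bef sym[of c e] sym[of f e]
      by (simp add: b_def P_def scalar_product_def matrix_vector_mult_def vec_eq_iff forall_3)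
    moreover have "invertible P" using invP by (simp add: invertible_det_nz)
    ultimately have "A *v e = 0" using invertible_iff_ker by blast
    then show False using nondeg e0 by blast
  qed
  define k where "k = - b e e / (2 * b c f)"
  have k0: "k \<noteq> 0" using bee bcf by (simp add: k_def)
  define Q :: "'k ^ 3 ^ 3" where "Q = vector [c, e, k *s f]"
  have Qt: "transpose Q *v y = y$1 *s c + y$2 *s e + (y$3 * k) *s f" for y :: "'k ^ 3"
    by (simp add: vec_eq_iff Q_def transpose_def matrix_vector_mult_def sum_3 mult_ac)
  have invQ: "invertible (transpose Q)"
    unfolding invertible_iff_ker Qt
  proof (intro allI impI)
    fix y :: "'k ^ 3" assume "y$1 *s c + y$2 *s e + (y$3 * k) *s f = 0"
    from bas[OF this e0] show "y = 0" using k0 by (simp add: vec_eq_iff forall_3)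
  qed
  define \<phi> where
    "\<phi> = (\<lambda>v :: 'k ^ 2. transpose Q *v vector [(v $ 1)^2, v $ 1 * v $ 2, (v $ 2)^2])"
  have "on_conic A (\<phi> v)" for v
  proof -
    have "b (\<phi> v) (\<phi> v) = (v$1)^2 * (v$2)^2 * (2 * k * b c f + b e e)"
      unfolding \<phi>_def Qt
      by (simp add: ladd radd lsc rsc bcc bff bec bef sym[of c e] sym[of f e] sym[of f c]
          algebra_simps power2_eq_square)
    also have "2 * k * b c f + b e e = 0" using bcf by (simp add: k_def)
    finally show ?thesis unfolding on_conic_def b_def by simp
  qed
  then have "conic_parametrization A \<phi>"
    unfolding conic_parametrization_def using invQ \<phi>_def by blast
  then show ?thesis by blast
qed

end

theory Submission
  imports Defs
begin

text \<open>
  Write \<open>F u v\<close> for the value of the dual form \<open>B'\<close> on the line joining the points with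
  parameters \<open>u\<close> and \<open>v\<close>. This is a symmetric form of bidegree \<open>(2,2)\<close>, and the points form a
  Poncelet chain iff, for each interior \<open>i\<close>, the quadratic form \<open>F (v i)\<close> is a nonzero multiple
  of \<open>y \<mapsto> [i-1,y][i+1,y]\<close>. Evaluating \<open>F\<close> at the pairs \<open>24\<close>, \<open>46\<close>, \<open>62\<close> in both orders and
  multiplying the three resulting equations gives the bracket equation. Conversely, the dual conics
  touching the lines \<open>23\<close>, \<open>34\<close>, \<open>45\<close>, \<open>56\<close> form a pencil spanned by two pairs of points,
  \<open>p\<^sub>3, p\<^sub>5\<close> and \<open>p\<^sub>4, q\<close> with \<open>q\<close> the intersection of \<open>23\<close> and \<open>56\<close>; the bracket
  equation says that the member touching \<open>12\<close> also touches \<open>67\<close>.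
\<close>

section \<open>Equality of homogeneous coordinates\<close>

lemma same_proj_refl: "same_proj x x"
  unfolding same_proj_def by (intro exI[of _ 1]) simp

lemma same_proj_sym: "same_proj x y \<Longrightarrow> same_proj y x"
  unfolding same_proj_def
proof (elim exE conjE)
  fix c assume "c \<noteq> 0" "y = c *s x"
  then show "\<exists>c. c \<noteq> 0 \<and> x = c *s y"
    by (intro exI[of _ "inverse c"]) (simp add: vector_smult_assoc)
qed

lemma same_proj_trans: "same_proj x y \<Longrightarrow> same_proj y z \<Longrightarrow> same_proj x z"
  unfolding same_proj_def by (metis mult_eq_0_iff vector_smult_assoc)

lemma matrix_vector_mult_smult:
  fixes M :: "'k::field ^ 'n ^ 'm"
  shows "M *v (c *s x) = c *s (M *v x)"
  by (simp add: vector_scalar_commute)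

lemma same_proj_nonzero: "same_proj x y \<Longrightarrow> x \<noteq> 0 \<Longrightarrow> y \<noteq> 0"
  unfolding same_proj_def by auto

lemma incident_same_proj:
  fixes x l :: "'k::field ^ 3"
  shows "same_proj x y \<Longrightarrow> incident x l \<longleftrightarrow> incident y l"
    and "same_proj l m \<Longrightarrow> incident x l \<longleftrightarrow> incident x m"
  unfolding same_proj_def incident_def by (auto simp: scalar_product_scale)

lemma on_conic_same_proj:
  fixes x y :: "'k::field ^ 3"
  shows "same_proj x y \<Longrightarrow> on_conic A x \<longleftrightarrow> on_conic A y"
  unfolding same_proj_def on_conic_def
  by (auto simp: scalar_product_scale matrix_vector_mult_smult)

lemma tangent_line_same_proj:
  fixes l m :: "'k::field ^ 3"
  shows "same_proj l m \<Longrightarrow> tangent_line B l \<longleftrightarrow> tangent_line B m"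
  unfolding same_proj_def tangent_line_def
  by (auto simp: scalar_product_scale matrix_vector_mult_smult)

section \<open>Brackets of parameters\<close>

lemma bracket_eq: "bracket u v = u $ 1 * v $ 2 - u $ 2 * v $ 1"
  by (simp add: bracket_def det_2)

lemma bracket_swap: "bracket u v = - bracket v u"
  by (simp add: bracket_eq)

lemma bracket_eq_0_imp:
  fixes u v :: "'k::field ^ 2"
  assumes "u \<noteq> 0" "bracket u v = 0"
  shows "\<exists>c. v = c *s u"
proof (cases "u $ 1 = 0")
  case True
  then have "u $ 2 \<noteq> 0" using assms(1) by (auto simp: vec_eq_iff forall_2)
  then show ?thesis using True assms(2)
    by (intro exI[of _ "v $ 2 / u $ 2"]) (auto simp: vec_eq_iff forall_2 bracket_eq)
next
  case False
  then show ?thesis using assms(2)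
    by (intro exI[of _ "v $ 1 / u $ 1"]) (auto simp: vec_eq_iff forall_2 bracket_eq field_simps)
qed

lemma bracket_eq_0_imp_same_proj:
  assumes "u \<noteq> 0" "v \<noteq> 0" "bracket u v = 0"
  shows "same_proj u v"
  using bracket_eq_0_imp[OF assms(1,3)] assms(2) unfolding same_proj_def by auto

section \<open>The standard conic, its chords and binary quadratic forms\<close>

definition veronese :: "'k::field ^ 2 \<Rightarrow> 'k ^ 3" where
  "veronese v = vector [(v $ 1)^2, v $ 1 * v $ 2, (v $ 2)^2]"

text \<open>These are the coefficients of the binary form sending \<open>x\<close> to
  \<open>bracket u x * bracket v x\<close>. For \<open>u = v\<close> the line is the tangent at that
  point.\<close>

definition chord :: "'k::field ^ 2 \<Rightarrow> 'k ^ 2 \<Rightarrow> 'k ^ 3" where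
  "chord u v = vector [u $ 2 * v $ 2, - (u $ 1 * v $ 2 + u $ 2 * v $ 1), u $ 1 * v $ 1]"

lemma veronese_chord:
  "scalar_product (veronese x) (chord u v) = bracket u x * bracket v x"
  by (simp add: scalar_product_def sum_3 veronese_def chord_def bracket_eq algebra_simps power2_eq_square)

lemma veronese_scale: "veronese (c *s v) = c^2 *s veronese v"
  by (simp add: veronese_def vec_eq_iff forall_3 power2_eq_square algebra_simps)

lemma chord_commute: "chord u v = chord v u"
  by (simp add: chord_def mult.commute add.commute)

lemma chord_scale: "chord u (c *s v) = c *s chord u v"
  by (simp add: chord_def vec_eq_iff forall_3 algebra_simps)

lemma chord_expand:
  "chord u y = y $ 1 *s chord u (axis 1 1) + y $ 2 *s chord u (axis 2 1)"
  by (simp add: chord_def vec_eq_iff forall_3 axis_def algebra_simps)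

lemma chord_nonzero:
  assumes "u \<noteq> 0" "v \<noteq> 0" shows "chord u v \<noteq> 0"
  using assms by (auto simp: chord_def vec_eq_iff forall_3 forall_2)

text \<open>A binary quadratic form with root \<open>u\<close> is divisible by the linear form
  \<open>bracket u\<close>; the other factor is \<open>bracket y\<close>.\<close>

lemma veronese_root_imp_chord:
  fixes u :: "'k::field ^ 2"
  assumes "u \<noteq> 0" "scalar_product (veronese u) m = 0"
  shows "\<exists>y. m = chord u y"
proof -
  have q: "(u $ 1)^2 * m $ 1 + u $ 1 * u $ 2 * m $ 2 + (u $ 2)^2 * m $ 3 = 0"
    using assms(2) by (simp add: scalar_product_def sum_3 veronese_def)
  show ?thesis
  proof (cases "u $ 1 = 0")
    case True
    then have u2: "u $ 2 \<noteq> 0" using assms(1) by (auto simp: vec_eq_iff forall_2)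
    then have "m $ 3 = 0" using q True by simp
    then show ?thesis using True u2
      by (intro exI[of _ "vector [- m $ 2 / u $ 2, m $ 1 / u $ 2]"])
        (simp add: vec_eq_iff forall_3 chord_def)
  next
    case False
    \<comment> \<open>The other two coordinates of \<open>m = chord u y\<close> already determine
      \<open>y\<close>; this is the remaining condition, obtained by solving the root equation for
      \<open>m $ 1\<close>.\<close>
    have "m $ 1 = - (u $ 2 * (m $ 2 + u $ 2 * m $ 3 / u $ 1)) / u $ 1"
      using q False by (simp add: field_simps power2_eq_square) algebra
    then show ?thesis using False
      by (intro exI[of _ "vector [m $ 3 / u $ 1, - (m $ 2 + u $ 2 * m $ 3 / u $ 1) / u $ 1]"])
        (simp add: vec_eq_iff forall_3 chord_def field_simps)
  qed
qed

lemma veronese_two_roots_imp_chord: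
  fixes u v :: "'k::field ^ 2"
  assumes "bracket u v \<noteq> 0"
    and "scalar_product (veronese u) m = 0" "scalar_product (veronese v) m = 0"
  shows "\<exists>k. m = k *s chord u v"
proof -
  have "u \<noteq> 0" "v \<noteq> 0" using assms(1) by (auto simp: bracket_eq)
  from veronese_root_imp_chord[OF this(1) assms(2)] obtain y where y: "m = chord u y" ..
  have "bracket v y = 0"
    using assms(1,3) bracket_swap[of v y] unfolding y veronese_chord by simp
  from bracket_eq_0_imp[OF \<open>v \<noteq> 0\<close> this] show ?thesis
    unfolding y by (auto simp: chord_scale)
qed

section \<open>Dual conics and pencils spanned by point pairs\<close>

text \<open>Tangency involves only \<open>B'\<close>, so a dual form can be constructed first; its
  point conic is then the inverse matrix or, for singular \<open>B'\<close>, a double line.\<close>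

lemma primal_conic_exists:
  fixes B' :: "'k::field ^ 3 ^ 3"
  assumes "B' \<noteq> 0" "transpose B' = B'"
  shows "\<exists>B. primal_dual_conic B B'"
proof (cases "invertible B'")
  case True
  then obtain B where B: "B ** B' = mat 1" "B' ** B = mat 1"
    unfolding invertible_def by blast
  have "transpose B = transpose B ** (B' ** B)" by (simp add: B)
  also have "\<dots> = transpose (B' ** B) ** B"
    by (simp add: matrix_mul_assoc matrix_transpose_mul assms(2))
  also have "\<dots> = B" by (simp add: B)
  finally have "transpose B = B" .
  moreover have "B \<noteq> 0"
    using B(1) assms(1) by (metis matrix_mul_lid matrix_mul_assoc matrix_mul_rid times0_left)
  ultimately show ?thesis
    using assms B unfolding primal_dual_conic_def by blast
next
  case False
  then obtain x where x: "B' *v x = 0" "x \<noteq> 0"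
    unfolding invertible_iff_ker by blast
  \<comment> \<open>The double line with coordinates \<open>x\<close>. As \<open>B'\<close> is
    symmetric and kills \<open>x\<close>, the product \<open>B ** B'\<close> is zero.\<close>
  define B :: "'k ^ 3 ^ 3" where "B = (\<chi> i j. x $ i * x $ j)"
  have sym: "B' $ i $ j = B' $ j $ i" for i j
    using arg_cong[OF assms(2), of "\<lambda>X. X $ j $ i"] by (simp add: transpose_def)
  have "(\<Sum>k\<in>UNIV. x $ k * B' $ k $ j) = (B' *v x) $ j" for j
    by (simp add: matrix_vector_mult_def sym[of _ j] mult.commute)
  then have "(\<Sum>k\<in>UNIV. x $ k * B' $ k $ j) = 0" for j
    using x by simp
  then have "B ** B' = mat 0"
    by (simp add: B_def matrix_matrix_mult_def mat_def vec_eq_iff mult.assoc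
        flip: sum_distrib_left)
  moreover have "B \<noteq> 0"
  proof
    assume "B = 0"
    then have "x $ i * x $ i = 0" for i by (simp add: B_def vec_eq_iff)
    then show False using x(2) by (simp add: vec_eq_iff)
  qed
  moreover have "transpose B = B"
    by (simp add: B_def transpose_def vec_eq_iff mult.commute)
  ultimately show ?thesis using assms unfolding primal_dual_conic_def by blast
qed

text \<open>As a dual conic, a pair of points consists of the lines through one of them.\<close>

definition point_pairs_pencil ::
    "'k::field \<Rightarrow> 'k ^ 3 \<Rightarrow> 'k ^ 3 \<Rightarrow> 'k \<Rightarrow> 'k ^ 3 \<Rightarrow> 'k ^ 3 \<Rightarrow> 'k ^ 3 ^ 3" where
  "point_pairs_pencil r a b s c d =
     (\<chi> i j. r * (a $ i * b $ j + b $ i * a $ j) + s * (c $ i * d $ j + d $ i * c $ j))"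

lemma point_pairs_pencil_form:
  fixes l :: "'k::field ^ 3"
  shows "scalar_product l (point_pairs_pencil r a b s c d *v l) =
    2 * (r * (scalar_product a l * scalar_product b l)
       + s * (scalar_product c l * scalar_product d l))"
  by (simp add: point_pairs_pencil_def scalar_product_def matrix_vector_mult_def sum_3)
    (simp add: algebra_simps)

lemma point_pairs_pencil_symmetric:
  "transpose (point_pairs_pencil r a b s c d) = point_pairs_pencil r a b s c d"
  by (simp add: point_pairs_pencil_def transpose_def vec_eq_iff algebra_simps)

definition meet :: "'k::field ^ 3 \<Rightarrow> 'k ^ 3 \<Rightarrow> 'k ^ 3" where
  "meet l m = vector [l$2 * m$3 - l$3 * m$2, l$3 * m$1 - l$1 * m$3, l$1 * m$2 - l$2 * m$1]"

text \<open>Both sides are linear in \<open>x\<close>. The meet lies on \<open>chord a b\<close>,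
  which forces a zero at \<open>x = b\<close>; if \<open>c\<close> or \<open>d\<close> equals
  \<open>a\<close>, the meet is a multiple of the conic point of \<open>a\<close>, which forces the
  other two factors.\<close>

lemma meet_chord_chord:
  fixes a b c d x :: "'k::field ^ 2"
  shows "scalar_product (meet (chord a b) (chord c d)) (chord a x) =
      bracket x b * bracket a c * bracket a d"
    and "scalar_product (meet (chord c d) (chord a b)) (chord a x) =
      bracket b x * bracket a c * bracket a d"
  by (simp_all add: meet_def chord_def scalar_product_def sum_3 bracket_eq) algebra+

text \<open>The bracket equation in the form in which the pencil of dual conics produces it.\<close>

lemma bracket_equation_alt:
  fixes v1 v2 v3 v4 v5 v6 v7 :: "'k::field ^ 2"
  shows "bracket v7 v4 * bracket v1 v6 * bracket v5 v4 * bracket v3 v2 -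
       bracket v7 v2 * bracket v1 v4 * bracket v5 v6 * bracket v3 v4 =
       bracket v1 v4 * bracket v2 v4 * bracket v3 v7 * bracket v5 v6
     - bracket v1 v5 * bracket v2 v3 * bracket v4 v6 * bracket v4 v7"
  unfolding bracket_eq by algebra

section \<open>Lines in terms of parameters on the conic \<open>A\<close>\<close>

text \<open>\<open>M\<close> carries the standard conic to \<open>A\<close>; \<open>N\<close>,
  inverse to \<open>transpose M\<close>, carries line coordinates along so that incidence is
  preserved.\<close>

locale parametrized_conic =
  fixes A M N :: "'k::field_char_0 ^ 3 ^ 3" and \<phi> :: "'k ^ 2 \<Rightarrow> 'k ^ 3"
  assumes nondegenerate: "nondegenerate_conic A"
    and parametrization: "conic_parametrization A \<phi>"
    and \<phi>_eq: "\<phi> v = M *v veronese v"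
    and dual: "transpose M ** N = mat 1"
begin

definition line :: "'k ^ 2 \<Rightarrow> 'k ^ 2 \<Rightarrow> 'k ^ 3" where
  "line u v = N *v chord u v"

lemma scalar_product_dual: "scalar_product (M *v x) (N *v m) = scalar_product x m"
  unfolding scalar_product_transpose by (simp add: matrix_vector_mul_assoc dual)

lemma \<phi>_line: "scalar_product (\<phi> x) (line u v) = bracket u x * bracket v x"
  unfolding \<phi>_eq line_def scalar_product_dual veronese_chord ..

lemma incident_line: "incident (\<phi> x) (line u v) \<longleftrightarrow> bracket u x = 0 \<or> bracket v x = 0"
  by (simp add: incident_def \<phi>_line)

lemma incident_line_ends: "incident (\<phi> u) (line u v)" "incident (\<phi> v) (line u v)"
  by (simp_all add: incident_line bracket_eq)

lemma line_commute: "line u v = line v u"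
  by (simp add: line_def chord_commute)

lemma line_dual: "N *v (transpose M *v k) = k"
proof -
  have "N ** transpose M = mat 1"
    using dual matrix_left_right_inverse by blast
  then show ?thesis
    by (simp only: matrix_vector_mul_assoc matrix_vector_mul_lid)
qed

lemma line_nonzero: "u \<noteq> 0 \<Longrightarrow> v \<noteq> 0 \<Longrightarrow> line u v \<noteq> 0"
  using chord_nonzero[of u v] unfolding line_def
  by (metis dual matrix_vector_mul_assoc matrix_vector_mul_lid matrix_vector_mult_0_right)

lemma line_same_proj: "same_proj v w \<Longrightarrow> same_proj (line u v) (line u w)"
  unfolding same_proj_def line_def by (auto simp: chord_scale matrix_vector_mult_smult)

lemma \<phi>_same_proj: "same_proj v w \<Longrightarrow> same_proj (\<phi> v) (\<phi> w)"
  unfolding same_proj_def \<phi>_eq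
  by (metis veronese_scale matrix_vector_mult_smult power_not_zero)

text \<open>Pulled back by \<open>transpose M\<close>, the line restricts to the conic as a
  quadratic form with root \<open>u\<close>. Its other root \<open>y\<close> may be proportional to
  \<open>u\<close>, the tangent case.\<close>

lemma incident_imp_line:
  assumes "u \<noteq> 0" "k \<noteq> 0" "incident (\<phi> u) k"
  shows "\<exists>y. y \<noteq> 0 \<and> k = line u y"
proof -
  have "scalar_product (veronese u) (transpose M *v k) = 0"
    using assms(3) unfolding incident_def \<phi>_eq scalar_product_transpose .
  then obtain y where y: "transpose M *v k = chord u y"
    using veronese_root_imp_chord assms(1) by blast
  then have "k = line u y" using line_dual[of k] by (simp add: line_def)
  moreover have "chord u 0 = 0" by (simp add: chord_def vec_eq_iff forall_3)
  then have "y \<noteq> 0" using assms(2) calculation by (auto simp: line_def)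
  ultimately show ?thesis by blast
qed

lemma incident_two_imp_line:
  assumes "bracket u v \<noteq> 0" "k \<noteq> 0" "incident (\<phi> u) k" "incident (\<phi> v) k"
  shows "same_proj k (line u v)"
proof -
  have 0: "u \<noteq> 0" "v \<noteq> 0" using assms(1) by (auto simp: bracket_eq)
  obtain y where y: "y \<noteq> 0" "k = line u y"
    using incident_imp_line 0 assms by blast
  then have "bracket y v = 0" using assms by (simp add: incident_line)
  then show ?thesis using y 0 by (auto intro: line_same_proj bracket_eq_0_imp_same_proj)
qed

section \<open>The dual form on chords\<close>

text \<open>This is the form \<open>F\<close> for the dual conic with matrix
  \<open>B\<close>.\<close>

definition line_form :: "'k ^ 3 ^ 3 \<Rightarrow> 'k ^ 2 \<Rightarrow> 'k ^ 2 \<Rightarrow> 'k" where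
  "line_form B u v = scalar_product (line u v) (B *v line u v)"

lemma tangent_line_iff: "tangent_line B (line u v) \<longleftrightarrow> line_form B u v = 0"
  by (simp add: tangent_line_def line_form_def)

lemma line_form_commute: "line_form B u v = line_form B v u"
  by (simp add: line_form_def line_commute)

text \<open>\<open>line u y\<close> is linear in \<open>y\<close>, so a quadratic form evaluated on
  it is a binary quadratic form in \<open>y\<close>; \<open>m\<close> collects its
  coefficients.\<close>

lemma line_form_quadratic: "\<exists>m. \<forall>y. line_form B u y = scalar_product (veronese y) m"
proof (intro exI allI)
  fix y
  define a b where "a = line u (axis 1 1)" and "b = line u (axis 2 1)"
  have "line u y = y $ 1 *s a + y $ 2 *s b"
    unfolding a_def b_def line_def
    by (subst chord_expand) (simp add: matrix_vector_right_distrib matrix_vector_mult_smult)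
  then show "line_form B u y = scalar_product (veronese y)
    (vector [scalar_product a (B *v a), scalar_product a (B *v b) + scalar_product b (B *v a),
      scalar_product b (B *v b)])"
    by (simp add: line_form_def scalar_product_add scalar_product_scale
        matrix_vector_right_distrib matrix_vector_mult_smult)
      (simp add: scalar_product_def sum_3 veronese_def algebra_simps power2_eq_square)
qed

text \<open>Two independent roots determine a binary quadratic form up to a scalar. The scalar is
  zero when all lines through the point of \<open>u\<close> are tangents.\<close>

lemma line_form_two_roots:
  assumes "bracket a b \<noteq> 0" "line_form B u a = 0" "line_form B u b = 0"
  obtains k where "\<And>y. line_form B u y = k * (bracket a y * bracket b y)"
proof -
  obtain m where m: "\<And>y. line_form B u y = scalar_product (veronese y) m"
    using line_form_quadratic by blast
  obtain k where "m = k *s chord a b"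
    using veronese_two_roots_imp_chord assms unfolding m by blast
  then show ?thesis by (intro that[of k]) (simp add: m scalar_product_scale veronese_chord)
qed

section \<open>Intersections and tangents in terms of parameters\<close>

lemma intersections_are_line:
  assumes "u \<noteq> 0" "v \<noteq> 0" "same_proj (\<phi> u) p" "same_proj (\<phi> v) q"
  shows "intersections_are A (line u v) p q"
  unfolding intersections_are_def
proof (intro allI impI iffI)
  fix x :: "'k ^ 3" assume "x \<noteq> 0" and x: "incident x (line u v) \<and> on_conic A x"
  then obtain w where w: "w \<noteq> 0" "same_proj (\<phi> w) x"
    using conic_parametrization_surj[OF nondegenerate parametrization] by blast
  then have "bracket u w = 0 \<or> bracket v w = 0"
    using x incident_line incident_same_proj by blast
  then have "same_proj u w \<or> same_proj v w"
    using assms w bracket_eq_0_imp_same_proj by blast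
  then show "same_proj x p \<or> same_proj x q"
    using assms w \<phi>_same_proj same_proj_sym same_proj_trans by meson
next
  fix x :: "'k ^ 3" assume "same_proj x p \<or> same_proj x q"
  then have "same_proj (\<phi> u) x \<or> same_proj (\<phi> v) x"
    using assms same_proj_sym same_proj_trans by blast
  moreover have "on_conic A (\<phi> w)" for w
    using parametrization unfolding conic_parametrization_def by blast
  ultimately show "incident x (line u v) \<and> on_conic A x"
    using incident_line_ends incident_same_proj(1) on_conic_same_proj by blast
qed

text \<open>The value at \<open>z\<close> excludes that the form vanishes identically, as it does
  when the dual conic is a point pair containing \<open>p\<close>. Then \<open>a\<close> and
  \<open>b\<close> are its only roots.\<close>

lemma tangents_are_lines:
  assumes nz: "u \<noteq> 0" "a \<noteq> 0" "b \<noteq> 0" and p: "same_proj (\<phi> u) p"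
    and ab: "bracket a b \<noteq> 0" "line_form B u a = 0" "line_form B u b = 0"
    and z: "line_form B u z \<noteq> 0"
  shows "tangents_are B p (line u a) (line u b)"
  unfolding tangents_are_def
proof (intro allI impI iffI)
  fix k :: "'k ^ 3" assume "k \<noteq> 0" and k: "incident p k \<and> tangent_line B k"
  then obtain y where y: "y \<noteq> 0" "k = line u y"
    using incident_imp_line incident_same_proj(1)[OF p] nz(1) by blast
  obtain c where c: "\<And>y. line_form B u y = c * (bracket a y * bracket b y)"
    using line_form_two_roots[OF ab] by blast
  have "line_form B u y = 0" using k unfolding y tangent_line_iff by blast
  then have "bracket a y = 0 \<or> bracket b y = 0" using c z by auto
  then have "same_proj a y \<or> same_proj b y"
    using nz y bracket_eq_0_imp_same_proj by blast
  then show "same_proj k (line u a) \<or> same_proj k (line u b)"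
    unfolding y using line_same_proj same_proj_sym by blast
next
  fix k :: "'k ^ 3" assume "same_proj k (line u a) \<or> same_proj k (line u b)"
  then show "incident p k \<and> tangent_line B k"
    using ab(2,3) incident_line_ends(1) incident_same_proj[of _ _] p tangent_line_iff
      tangent_line_same_proj by meson
qed

section \<open>Poncelet chains as zeros of the dual form\<close>

context
  fixes n :: nat and p :: "nat \<Rightarrow> 'k ^ 3" and v :: "nat \<Rightarrow> 'k ^ 2"
  assumes v: "\<And>i. i \<in> {1..n} \<Longrightarrow> v i \<noteq> 0 \<and> same_proj (\<phi> (v i)) (p i)"
    and distinct: "pairwise_distinct_points n p"
begin

lemma bracket_nonzero:
  assumes "i \<in> {1..n}" "j \<in> {1..n}" "i \<noteq> j"
  shows "bracket (v i) (v j) \<noteq> 0"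
proof
  assume "bracket (v i) (v j) = 0"
  then have "same_proj (\<phi> (v i)) (\<phi> (v j))"
    using v assms by (auto intro: \<phi>_same_proj bracket_eq_0_imp_same_proj)
  then have "same_proj (p i) (p j)"
    using v assms same_proj_sym same_proj_trans by meson
  then show False
    using distinct assms unfolding pairwise_distinct_points_def by blast
qed

text \<open>The only tangents through an interior point are its two chain lines. By distinctness
  neither contains any further \<open>p j\<close>, so the form is nonzero on the line to
  \<open>p j\<close>.\<close>

lemma poncelet_chain_imp_line_form:
  assumes chain: "poncelet_chain A B B' n p"
  shows "\<forall>i\<in>{1..<n}. line_form B' (v i) (v (i + 1)) = 0"
    and "\<forall>i\<in>{1..<n - 1}. \<forall>j\<in>{1..n} - {i, i + 1, i + 2}. line_form B' (v (i + 1)) (v j) \<noteq> 0"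
proof -
  obtain l where l: "\<And>i. i \<in> {1..<n} \<Longrightarrow> l i \<noteq> 0 \<and> tangent_line B' (l i) \<and>
        incident (p i) (l i) \<and> intersections_are A (l i) (p i) (p (i + 1))"
    and t: "\<And>i. i \<in> {1..<n - 1} \<Longrightarrow> tangents_are B' (p (i + 1)) (l i) (l (i + 1))"
    and p: "\<And>i. i \<in> {1..n} \<Longrightarrow> p i \<noteq> 0"
    using chain unfolding poncelet_chain_def by blast
  have line: "same_proj (l i) (line (v i) (v (i + 1)))" if i: "i \<in> {1..<n}" for i
  proof (rule incident_two_imp_line)
    have "incident (p (i + 1)) (l i)"
      using l[OF i] p[of "i + 1"] i same_proj_refl unfolding intersections_are_def by auto
    then show "incident (\<phi> (v (i + 1))) (l i)"
      using v[of "i + 1"] i incident_same_proj(1) by auto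
    show "incident (\<phi> (v i)) (l i)"
      using v[of i] i l[OF i] incident_same_proj(1) by auto
  qed (use l[OF i] i bracket_nonzero[of i "i + 1"] in auto)
  show "\<forall>i\<in>{1..<n}. line_form B' (v i) (v (i + 1)) = 0"
    using l line tangent_line_same_proj tangent_line_iff by blast
  show "\<forall>i\<in>{1..<n - 1}. \<forall>j\<in>{1..n} - {i, i + 1, i + 2}. line_form B' (v (i + 1)) (v j) \<noteq> 0"
  proof (intro ballI notI)
    fix i j assume i: "i \<in> {1..<n - 1}" and j: "j \<in> {1..n} - {i, i + 1, i + 2}"
      and 0: "line_form B' (v (i + 1)) (v j) = 0"
    have i12: "i + 1 \<in> {1..n}" "i + 2 \<in> {1..n}" "i \<in> {1..<n}" "i + 1 \<in> {1..<n}"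
      using i by auto
    have "tangent_line B' (line (v (i + 1)) (v j))"
      using 0 by (simp add: tangent_line_iff)
    moreover have "incident (p (i + 1)) (line (v (i + 1)) (v j))"
      using v[OF i12(1)] incident_line_ends(1) incident_same_proj(1) by blast
    moreover have "line (v (i + 1)) (v j) \<noteq> 0"
      using v[OF i12(1)] v[of j] j line_nonzero by blast
    ultimately have "same_proj (line (v (i + 1)) (v j)) (l i) \<or>
        same_proj (line (v (i + 1)) (v j)) (l (i + 1))"
      using t[OF i] unfolding tangents_are_def by blast
    then have "same_proj (line (v (i + 1)) (v j)) (line (v i) (v (i + 1))) \<or>
        same_proj (line (v (i + 1)) (v j)) (line (v (i + 1)) (v (i + 2)))"
      using line[OF i12(3)] line[OF i12(4)] same_proj_trans by (auto simp: add.assoc)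
    then have "incident (\<phi> (v j)) (line (v i) (v (i + 1))) \<or>
        incident (\<phi> (v j)) (line (v (i + 1)) (v (i + 2)))"
      using incident_line_ends(2) incident_same_proj(2) by blast
    then show False
      using i i12 j bracket_nonzero[of i j] bracket_nonzero[of "i + 1" j] bracket_nonzero[of "i + 2" j]
      by (auto simp: incident_line)
  qed
qed

text \<open>The joins of consecutive points serve as the chain lines. At each interior point one
  nonzero value ensures that there are no tangents besides these two.\<close>

lemma line_form_imp_poncelet_chain:
  assumes B': "B' \<noteq> 0" "transpose B' = B'"
    and tangent: "\<And>i. i \<in> {1..<n} \<Longrightarrow> line_form B' (v i) (v (i + 1)) = 0"
    and nonzero: "\<And>i. i \<in> {1..<n - 1} \<Longrightarrow> \<exists>z. line_form B' (v (i + 1)) z \<noteq> 0"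
  shows "\<exists>B. poncelet_chain A B B' n p"
proof -
  obtain B where B: "primal_dual_conic B B'"
    using primal_conic_exists[OF B'] ..
  let ?l = "\<lambda>i. line (v i) (v (i + 1))"
  have "p i \<noteq> 0 \<and> on_conic A (p i)" if "i \<in> {1..n}" for i
  proof
    have M: "invertible (transpose M)"
      using dual invertible_right_inverse by blast
    have "veronese (v i) \<noteq> 0"
      using v[OF that] by (auto simp: veronese_def vec_eq_iff forall_3 forall_2)
    then have "\<phi> (v i) \<noteq> 0"
      using M invertible_iff_ker[of M] unfolding \<phi>_eq by (auto simp: invertible_det_nz)
    then show "p i \<noteq> 0" using v[OF that] same_proj_nonzero by blast
    show "on_conic A (p i)"
      using v[OF that] parametrization on_conic_same_proj
      unfolding conic_parametrization_def by blast
  qed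
  moreover have "?l i \<noteq> 0 \<and> tangent_line B' (?l i) \<and> incident (p i) (?l i) \<and>
      intersections_are A (?l i) (p i) (p (i + 1))" if i: "i \<in> {1..<n}" for i
    using v[of i] v[of "i + 1"] i tangent[OF i] incident_line_ends(1)[of "v i" "v (i + 1)"]
      incident_same_proj(1)[of "\<phi> (v i)" "p i"]
    by (auto simp: tangent_line_iff line_nonzero intro!: intersections_are_line)
  moreover have "tangents_are B' (p (i + 1)) (?l i) (?l (i + 1))" if i: "i \<in> {1..<n - 1}" for i
  proof -
    obtain z where "line_form B' (v (i + 1)) z \<noteq> 0" using nonzero[OF i] ..
    moreover have "i \<in> {1..n}" "i + 1 \<in> {1..n}" "i + 2 \<in> {1..n}" "i \<in> {1..<n}" "i + 1 \<in> {1..<n}"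
      using i by auto
    ultimately have "tangents_are B' (p (i + 1)) (line (v (i + 1)) (v i)) (?l (i + 1))"
      using v[of i] v[of "i + 1"] v[of "i + 2"] bracket_nonzero[of i "i + 2"]
        tangent[of i] tangent[of "i + 1"]
      by (intro tangents_are_lines)
        (auto simp: line_form_commute[of _ "v (Suc i)" "v i"])
    then show ?thesis by (simp only: line_commute[of "v i"])
  qed
  ultimately have "poncelet_chain A B B' n p"
    unfolding poncelet_chain_def using B by (intro conjI exI[of _ ?l]) simp_all
  then show ?thesis ..
qed

end


section \<open>The case of seven points\<close>

text \<open>Three of the points lie on \<open>A\<close>, so their incidences split into brackets;
  the fourth may lie off \<open>A\<close> and keeps its pairing with the chord.\<close>

lemma line_form_point_pairs_pencil:
  "line_form (point_pairs_pencil r (\<phi> a) (\<phi> b) s (\<phi> c) (M *v d)) u y =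
    2 * (r * (bracket u a * bracket y a * (bracket u b * bracket y b))
       + s * (bracket u c * bracket y c * scalar_product d (chord u y)))"
  unfolding line_form_def point_pairs_pencil_form \<phi>_line
  by (simp add: line_def scalar_product_dual)

lemma poncelet_chain_7_iff:
  assumes v: "\<And>i. i \<in> {1..7} \<Longrightarrow> v i \<noteq> 0 \<and> same_proj (\<phi> (v i)) (p i)"
    and distinct: "pairwise_distinct_points 7 p"
  shows "(\<exists>B B'. proper_poncelet_chain A B B' 7 p) \<longleftrightarrow>
     bracket (v 7) (v 4) * bracket (v 1) (v 6) * bracket (v 5) (v 4) * bracket (v 3) (v 2) =
     bracket (v 7) (v 2) * bracket (v 1) (v 4) * bracket (v 5) (v 6) * bracket (v 3) (v 4)"
    (is "?chain \<longleftrightarrow> ?eq")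
proof
  let ?b = "\<lambda>i j. bracket (v i) (v j)"
  note br = bracket_nonzero[OF v distinct]
  assume ?chain
  then obtain B B' where chain: "poncelet_chain A B B' 7 p"
    unfolding proper_poncelet_chain_def by blast
  let ?F = "\<lambda>i j. line_form B' (v i) (v j)"
  note z = bspec[OF poncelet_chain_imp_line_form(1)[OF v distinct chain]]
  note nz = bspec[OF bspec[OF poncelet_chain_imp_line_form(2)[OF v distinct chain]]]
  \<comment> \<open>With the even index first, the two roots of each form are the neighbours of that
    point.\<close>
  have z: "?F 2 1 = 0" "?F 2 3 = 0" "?F 4 3 = 0" "?F 4 5 = 0" "?F 6 5 = 0" "?F 6 7 = 0"
    using z[of 1] z[of 2] z[of 3] z[of 4] z[of 5] z[of 6] line_form_commute[of B' "v 2" "v 1"]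
      line_form_commute[of B' "v 4" "v 3"] line_form_commute[of B' "v 6" "v 5"]
    by (simp_all add: eval_nat_numeral)
  have nz: "?F 2 4 \<noteq> 0" "?F 4 6 \<noteq> 0" "?F 6 2 \<noteq> 0"
    using nz[of 1 4] nz[of 3 6] nz[of 5 2] by (simp_all add: numeral_2_eq_2)
  obtain d where d: "\<And>y. line_form B' (v 2) y = d * (bracket (v 1) y * bracket (v 3) y)"
    using line_form_two_roots[OF _ z(1,2)] br[of 1 3] by auto
  obtain b where b: "\<And>y. line_form B' (v 4) y = b * (bracket (v 3) y * bracket (v 5) y)"
    using line_form_two_roots[OF _ z(3,4)] br[of 3 5] by auto
  obtain e where e: "\<And>y. line_form B' (v 6) y = e * (bracket (v 5) y * bracket (v 7) y)"
    using line_form_two_roots[OF _ z(5,6)] br[of 5 7] by auto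
  have "d * (?b 1 4 * ?b 3 4) = b * (?b 3 2 * ?b 5 2)"
    "b * (?b 3 6 * ?b 5 6) = e * (?b 5 4 * ?b 7 4)"
    "e * (?b 5 2 * ?b 7 2) = d * (?b 1 6 * ?b 3 6)"
    using line_form_commute[of B' "v 2" "v 4"] line_form_commute[of B' "v 4" "v 6"]
      line_form_commute[of B' "v 6" "v 2"] by (simp_all only: d b e)
  then have "d * (?b 1 4 * ?b 3 4) * (b * (?b 3 6 * ?b 5 6)) * (e * (?b 5 2 * ?b 7 2)) =
     b * (?b 3 2 * ?b 5 2) * (e * (?b 5 4 * ?b 7 4)) * (d * (?b 1 6 * ?b 3 6))"
    by simp
  \<comment> \<open>Both products contain this factor; cancelling it leaves the bracket
    equation.\<close>
  moreover have "d * b * e * ?b 3 6 * ?b 5 2 \<noteq> 0"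
    using nz br[of 3 6] br[of 5 2] by (simp add: d b e)
  ultimately show ?eq by algebra
next
  let ?b = "\<lambda>i j. bracket (v i) (v j)"
  note br = bracket_nonzero[OF v distinct]
  assume eq: ?eq
  define q where "q = meet (chord (v 2) (v 3)) (chord (v 5) (v 6))"
  \<comment> \<open>The weights make the pencil member touch 12: up to the factor
    \<open>2 * ?b 1 3 * ?b 2 5\<close>, the value \<open>?F 2 1\<close> is
    \<open>r * ?b 2 3 * ?b 1 5 + s * ?b 2 4 * ?b 1 4 * ?b 2 6\<close>.\<close>
  define r s where "r = ?b 2 4 * ?b 1 4 * ?b 2 6" and "s = - (?b 2 3 * ?b 1 5)"
  define B' where "B' = point_pairs_pencil r (\<phi> (v 3)) (\<phi> (v 5)) s (\<phi> (v 4)) (M *v q)"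
  let ?F = "\<lambda>i j. line_form B' (v i) (v j)"
  have F: "?F i j = 2 * (r * (?b i 3 * ?b j 3 * (?b i 5 * ?b j 5))
      + s * (?b i 4 * ?b j 4 * scalar_product q (chord (v i) (v j))))" for i j
    unfolding B'_def line_form_point_pairs_pencil ..
  \<comment> \<open>As \<open>q\<close> lies on 23 and on 56, its pairing with any chord from 2, 3,
    5 or 6 splits into brackets.\<close>
  have q2: "scalar_product q (chord (v 2) x) = bracket x (v 3) * ?b 2 5 * ?b 2 6"
    and q3: "scalar_product q (chord (v 3) x) = bracket x (v 2) * ?b 3 5 * ?b 3 6"
    and q5: "scalar_product q (chord (v 5) x) = bracket (v 6) x * ?b 5 2 * ?b 5 3"
    and q6: "scalar_product q (chord (v 6) x) = bracket (v 5) x * ?b 6 2 * ?b 6 3" for x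
    using meet_chord_chord(1)[where a = "v 2" and b = "v 3" and c = "v 5" and d = "v 6"]
      meet_chord_chord(1)[where a = "v 3" and b = "v 2" and c = "v 5" and d = "v 6"]
      meet_chord_chord(2)[where a = "v 5" and b = "v 6" and c = "v 2" and d = "v 3"]
      meet_chord_chord(2)[where a = "v 6" and b = "v 5" and c = "v 2" and d = "v 3"]
    unfolding q_def chord_commute[of "v 3" "v 2"] chord_commute[of "v 6" "v 5"] by blast+
  have self: "?b i i = 0" for i by (simp add: bracket_eq)
  have F2: "?F 2 1 = 0"
    unfolding F q2 r_def s_def bracket_swap[of "v 3" "v 1"] by algebra
  note swap = bracket_swap[of "v 5" "v 1"] bracket_swap[of "v 6" "v 3"] bracket_swap[of "v 7" "v 3"]
    bracket_swap[of "v 6" "v 5"] bracket_swap[of "v 7" "v 5"] bracket_swap[of "v 6" "v 4"]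
    bracket_swap[of "v 7" "v 4"] bracket_swap[of "v 6" "v 2"]
  \<comment> \<open>\<open>?F 6 7\<close> is \<open>2 * ?b 6 3 * ?b 7 5 * ?b 2 6\<close> times the
    difference in \<open>bracket_equation_alt\<close>.\<close>
  have F6: "?F 6 7 = 0"
    using eq bracket_equation_alt[of "v 7" "v 4" "v 1" "v 6" "v 5" "v 3" "v 2"]
    unfolding F q6 r_def s_def swap by algebra
  have r0: "r \<noteq> 0" and s0: "s \<noteq> 0"
    using br by (simp_all add: r_def s_def)
  have tangent: "?F i (i + 1) = 0" if "i \<in> {1..<7}" for i
  proof -
    have "i \<in> {1, 2, 3, 4, 5, 6}" using that by auto
    moreover have "?F 1 2 = 0"
      using F2 line_form_commute by metis
    \<comment> \<open>Each of these lines contains a point of either pair: 3 or 5, and 4 or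
      \<open>q\<close>.\<close>
    moreover have "?F 2 3 = 0" "?F 3 4 = 0" "?F 4 5 = 0" "?F 5 6 = 0"
      by (simp_all add: F q2 q5 self)
    ultimately show ?thesis using F6 by (auto simp: eval_nat_numeral)
  qed
  \<comment> \<open>On lines through 4 only the term of 3 and 5 survives, on 35 only that of 4 and
    \<open>q\<close>; it is a product of nonzero factors. The three pairs cover all interior
    points.\<close>
  have nz: "?F 2 4 \<noteq> 0" "?F 6 4 \<noteq> 0" "?F 3 5 \<noteq> 0"
    using br r0 s0 by (simp_all add: F q3 self)
  have nz': "?F 4 2 \<noteq> 0" "?F 5 3 \<noteq> 0"
    using nz line_form_commute by metis+
  have nonzero: "\<exists>z. line_form B' (v (i + 1)) z \<noteq> 0" if "i \<in> {1..<7 - 1}" for i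
  proof -
    have "i \<in> {1, 2, 3, 4, 5}" using that by auto
    then show ?thesis using nz nz' by (auto simp: eval_nat_numeral)
  qed
  have "B' \<noteq> 0"
    using nz(1) by (auto simp: line_form_def scalar_product_def)
  moreover have "transpose B' = B'"
    unfolding B'_def by (rule point_pairs_pencil_symmetric)
  ultimately have "\<exists>B. poncelet_chain A B B' 7 p"
    using line_form_imp_poncelet_chain[OF v distinct _ _ tangent nonzero] by blast
  then show ?chain
    using distinct unfolding proper_poncelet_chain_def by blast
qed

end

section \<open>Arbitrary parametrizations, real and complex\<close>

text \<open>Any parametrization supplies \<open>M\<close>, and inverting \<open>transpose M\<close>
  supplies \<open>N\<close>. Working in characteristic 0 treats both fields at once.\<close>

lemma poncelet_chain_7_iff_bracket:
  fixes A :: "'k::field_char_0 ^ 3 ^ 3"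
  assumes "nondegenerate_conic A" "conic_parametrization A \<phi>" "pairwise_distinct_points 7 p"
    and "\<forall>i\<in>{1..7}. v i \<noteq> 0 \<and> same_proj (\<phi> (v i)) (p i)"
  shows "(\<exists>B B'. proper_poncelet_chain A B B' 7 p) \<longleftrightarrow>
     bracket (v 7) (v 4) * bracket (v 1) (v 6) * bracket (v 5) (v 4) * bracket (v 3) (v 2) =
     bracket (v 7) (v 2) * bracket (v 1) (v 4) * bracket (v 5) (v 6) * bracket (v 3) (v 4)"
proof -
  obtain M :: "'k ^ 3 ^ 3" where M: "invertible M" and "\<And>v. \<phi> v = M *v veronese v"
    using assms(2) unfolding conic_parametrization_def veronese_def by blast
  moreover have "invertible (transpose M)"
    using M by (simp add: invertible_det_nz)
  then obtain N where "transpose M ** N = mat 1"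
    unfolding invertible_def by blast
  ultimately interpret parametrized_conic A M N \<phi>
    using assms(1,2) by unfold_locales
  show ?thesis
    using poncelet_chain_7_iff assms(3,4) by blast
qed

theorem theorem1:
  shows
  "(\<forall>(A :: real ^ 3 ^ 3) (p :: nat \<Rightarrow> real ^ 3) (\<phi> :: real ^ 2 \<Rightarrow> real ^ 3) (v :: nat \<Rightarrow> real ^ 2).
      nondegenerate_conic A \<longrightarrow>
      (\<forall>i\<in>{1..7}. p i \<noteq> 0 \<and> on_conic A (p i)) \<longrightarrow>
      pairwise_distinct_points 7 p \<longrightarrow>
      conic_parametrization A \<phi> \<longrightarrow>
      (\<forall>i\<in>{1..7}. v i \<noteq> 0 \<and> same_proj (\<phi> (v i)) (p i)) \<longrightarrow>
      ((\<exists>B B'. proper_poncelet_chain A B B' 7 p) \<longleftrightarrow>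
       bracket (v 7) (v 4) * bracket (v 1) (v 6) * bracket (v 5) (v 4) * bracket (v 3) (v 2) =
       bracket (v 7) (v 2) * bracket (v 1) (v 4) * bracket (v 5) (v 6) * bracket (v 3) (v 4)))
   \<and>
   (\<forall>(A :: complex ^ 3 ^ 3) (p :: nat \<Rightarrow> complex ^ 3) (\<phi> :: complex ^ 2 \<Rightarrow> complex ^ 3)
      (v :: nat \<Rightarrow> complex ^ 2).
      nondegenerate_conic A \<longrightarrow>
      (\<forall>i\<in>{1..7}. p i \<noteq> 0 \<and> on_conic A (p i)) \<longrightarrow>
      pairwise_distinct_points 7 p \<longrightarrow>
      conic_parametrization A \<phi> \<longrightarrow>
      (\<forall>i\<in>{1..7}. v i \<noteq> 0 \<and> same_proj (\<phi> (v i)) (p i)) \<longrightarrow>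
      ((\<exists>B B'. proper_poncelet_chain A B B' 7 p) \<longleftrightarrow>
       bracket (v 7) (v 4) * bracket (v 1) (v 6) * bracket (v 5) (v 4) * bracket (v 3) (v 2) =
       bracket (v 7) (v 2) * bracket (v 1) (v 4) * bracket (v 5) (v 6) * bracket (v 3) (v 4)))"
  by (intro conjI allI impI; rule poncelet_chain_7_iff_bracket; assumption)

end
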